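(* Fix $h\in\mathbb C^\times$, let $U\subseteq\mathbb C$ be half-step-invariant, and let $X:U\to\mathbb C$ be an admissible map. Let $D,S:\mathcal P\to\mathcal P$ be the associated divided-difference and averaging operators, with transposes $\mathbf D,\mathbf S:\mathcal P'\to\mathcal P'$. Let either $I=\mathbb N$ and $I_1=\mathbb N$ (infinite case), or $I=\{0,1,\dots,N+1\}$ and $I_1=\{0,1,\dots,N\}$ for some $N\ge2$ (finite case). Let $\mathbf u\in\mathcal P'$ have the monic orthogonal polynomial sequence $(P_n)_{n\in I}$. Assume that $X$ belongs to the ordinary quadratic half-step branch, or to the $q$-exponential branch with $q$ not a root of unity. Fix polynomials $\phi$ and $\psi$, with $\deg\phi\le2$ and $\deg\psi\le1$, not both identically zero, such that $$\mathbf D(\phi\,\mathbf u)=\mathbf S(\psi\,\mathbf u).$$ In the finite case assume in addition that $d_j\neq0$ for $j=0,1,\dots,2N+1$. Set $$U_2=S(x^2)-(Sx)^2,\qquad \mathbf u^{[1]}=\mathbf D(U_2\,\psi\,\mathbf u)-\mathbf S(\phi\,\mathbf u),\qquad Q_n^{[1]}=\gamma_{n+1}^{-1}\,DP_{n+1}\quad(n\in I_1).$$ Then the functional $\mathbf u^{[1]}\in\mathcal P'$ is classical, and the family $(Q_n^{[1]})_{n\in I_1}$ is its monic orthogonal polynomial sequence.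
   Context: $\mathbb N=\{0,1,2,\dots\}$, $\mathbb C^\times=\mathbb C\setminus\{0\}$. Fix $h\in\mathbb C^\times$. A non-empty set $U\subseteq\mathbb C$ is half-step-invariant if $U\pm\frac h2\subseteq U$. For $X:U\to\mathbb C$ put $Y(s)=X(s+\frac h2)$, $Z(s)=X(s-\frac h2)$. $X$ is parametrising if $Y-Z$ vanishes nowhere on $U$; it is admissible if moreover $X(U)$ is infinite and for every complex polynomial $p$ of degree $\ge1$ there is a polynomial $Q$ with $\deg Q\le\deg p-1$ and $\frac{p(Y)-p(Z)}{Y-Z}=Q(X)$ throughout $U$. $\mathcal P$ is the space of complex polynomials, the inductive limit of the finite-dimensional spaces $\mathcal P_n$ of polynomials of degree at most $n$; its continuous dual $\mathcal P'$ coincides with the space of all linear functionals on $\mathcal P$. For admissible $X$, $Dp$ and $Sp$ are the unique polynomials with $(Dp)(X)=\frac{p(Y)-p(Z)}{Y-Z}$ and $(Sp)(X)=\frac{p(Y)+p(Z)}2$ throughout $U$. On $\mathcal P'$: $\langle p_0\mathbf u,p\rangle=\langle\mathbf u,p_0p\rangle$, $\langle\mathbf D\mathbf u,p\rangle=-\langle\mathbf u,Dp\rangle$, $\langle\mathbf S\mathbf u,p\rangle=\langle\mathbf u,Sp\rangle$. A family $(P_n)_{n\in I}$ with $\deg P_n=n$ is orthogonal with respect to $\mathbf u$ if $\langle\mathbf u,P_nP_m\rangle=0$ for $m,n\in I$, $m<n$, and $\langle\mathbf u,P_n^2\rangle\neq0$ for $n\in I$. $\mathbf u$ is regular if there is such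 a sequence indexed by $\mathbb N$, and regular of order $M+1$ if there is one indexed by $\{0,\dots,M\}$. $\mathbf u$ is classical (relative to $(U,X,h)$) if it is regular of order at least $3$ and there are polynomials $\phi,\psi$ with $\deg\phi\le2$, $\deg\psi\le1$, not both zero, with $\mathbf D(\phi\mathbf u)=\mathbf S(\psi\mathbf u)$. Branches: for admissible $X$ there are unique $\eta,\beta\in\mathbb C$ with $Y+Z=\eta X+\beta$ throughout $U$. Ordinary quadratic half-step branch: $\eta=2$. $q$-exponential branch: $\eta\notin\{0,2,-2\}$; then $q$ is a fixed solution of $q+q^{-1}=\eta^2-2$, $q^{1/2}$ is the unique square root of $q$ with $q^{1/2}+q^{-1/2}=\eta$, and $q^{n/2}=(q^{1/2})^n$. Write $\phi_2$ for the coefficient of $x^2$ in $\phi$ and $\psi_1$ for the coefficient of $x$ in $\psi$. In the quadratic branch, $\gamma_n=n$ and $d_n=\phi_2n+\psi_1$. In the $q$-exponential branch, $\gamma_n=\frac{q^{n/2}-q^{-n/2}}{q^{1/2}-q^{-1/2}}$, $\alpha_n=\frac{q^{n/2}+q^{-n/2}}2$ and $d_n=\phi_2\gamma_n+\psi_1\alpha_n$. *)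

theory Defs
  imports Complex_Main "HOL-Computational_Algebra.Polynomial"
begin

subsection \<open>Half-step lattices\<close>

definition half_step_invariant :: "complex \<Rightarrow> complex set \<Rightarrow> bool" where
  "half_step_invariant h U \<longleftrightarrow> U \<noteq> {} \<and> (\<forall>s\<in>U. s + h / 2 \<in> U \<and> s - h / 2 \<in> U)"

text \<open>A map \<open>X : U \<rightarrow> \<complex>\<close> is a total function of which only the values on \<open>U\<close> are ever used.\<close>

definition shift_up :: "complex \<Rightarrow> (complex \<Rightarrow> complex) \<Rightarrow> complex \<Rightarrow> complex" where
  "shift_up h X s = X (s + h / 2)"

definition shift_down :: "complex \<Rightarrow> (complex \<Rightarrow> complex) \<Rightarrow> complex \<Rightarrow> complex" where
  "shift_down h X s = X (s - h / 2)"

definition parametrising :: "complex \<Rightarrow> complex set \<Rightarrow> (complex \<Rightarrow> complex) \<Rightarrow> bool" where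
  "parametrising h U X \<longleftrightarrow> (\<forall>s\<in>U. shift_up h X s - shift_down h X s \<noteq> 0)"

definition div_diff :: "complex \<Rightarrow> (complex \<Rightarrow> complex) \<Rightarrow> complex poly \<Rightarrow> complex \<Rightarrow> complex" where
  "div_diff h X p s =
     (poly p (shift_up h X s) - poly p (shift_down h X s)) / (shift_up h X s - shift_down h X s)"

definition half_sum :: "complex \<Rightarrow> (complex \<Rightarrow> complex) \<Rightarrow> complex poly \<Rightarrow> complex \<Rightarrow> complex" where
  "half_sum h X p s = (poly p (shift_up h X s) + poly p (shift_down h X s)) / 2"

definition admissible :: "complex \<Rightarrow> complex set \<Rightarrow> (complex \<Rightarrow> complex) \<Rightarrow> bool" where
  "admissible h U X \<longleftrightarrow>
     parametrising h U X \<and> infinite (X ` U) \<and>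
     (\<forall>p. degree p \<ge> 1 \<longrightarrow>
        (\<exists>Q. degree Q \<le> degree p - 1 \<and> (\<forall>s\<in>U. div_diff h X p s = poly Q (X s))))"

text \<open>The definite descriptions are meaningful for admissible \<open>X\<close>; see \<open>Dop_eq\<close> and
  \<open>Sop_eq\<close> below.\<close>

definition Dop :: "complex \<Rightarrow> complex set \<Rightarrow> (complex \<Rightarrow> complex) \<Rightarrow> complex poly \<Rightarrow> complex poly" where
  "Dop h U X p = (THE r. \<forall>s\<in>U. poly r (X s) = div_diff h X p s)"

definition Sop :: "complex \<Rightarrow> complex set \<Rightarrow> (complex \<Rightarrow> complex) \<Rightarrow> complex poly \<Rightarrow> complex poly" where
  "Sop h U X p = (THE r. \<forall>s\<in>U. poly r (X s) = half_sum h X p s)"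

lemma poly_eq_on_infinite_image:
  fixes r r' :: "complex poly"
  assumes "infinite (X ` U)" and "\<forall>s\<in>U. poly r (X s) = poly r' (X s)"
  shows "r = r'"
proof (rule ccontr)
  assume "r \<noteq> r'"
  then have "finite {z. poly (r - r') z = 0}"
    by (intro poly_roots_finite) simp
  moreover have "X ` U \<subseteq> {z. poly (r - r') z = 0}"
    using assms(2) by auto
  ultimately show False
    using assms(1) finite_subset by blast
qed

lemma Dop_ex1:
  assumes "admissible h U X"
  shows "\<exists>!r. \<forall>s\<in>U. poly r (X s) = div_diff h X p s"
proof -
  have inf: "infinite (X ` U)"
    using assms by (simp add: admissible_def)
  have "\<exists>r. \<forall>s\<in>U. poly r (X s) = div_diff h X p s"
  proof (cases "degree p \<ge> 1")
    case True
    then show ?thesis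
      using assms unfolding admissible_def by metis
  next
    case False
    then have "degree p = 0"
      by simp
    then obtain c where "p = [:c:]"
      by (rule degree_eq_zeroE)
    then have "\<forall>s\<in>U. poly 0 (X s) = div_diff h X p s"
      by (simp add: div_diff_def)
    then show ?thesis
      by blast
  qed
  then show ?thesis
    using poly_eq_on_infinite_image[OF inf] by (metis (no_types, lifting))
qed

lemma Dop_eq:
  assumes "admissible h U X" and "s \<in> U"
  shows "poly (Dop h U X p) (X s) = div_diff h X p s"
  using theI'[OF Dop_ex1[OF assms(1)]] assms(2) unfolding Dop_def by blast

lemma Sop_ex1:
  assumes adm: "admissible h U X"
  shows "\<exists>!r. \<forall>s\<in>U. poly r (X s) = half_sum h X p s"
proof -
  have inf: "infinite (X ` U)"
    using adm by (simp add: admissible_def)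
  let ?r = "Dop h U X (pCons 0 p) - smult (1 / 2) (Dop h U X (monom 1 2) * Dop h U X p)"
  have "poly ?r (X s) = half_sum h X p s" if "s \<in> U" for s
  proof -
    define y z where "y = shift_up h X s" and "z = shift_down h X s"
    have nz: "y - z \<noteq> 0"
      using adm that by (simp add: admissible_def parametrising_def y_def z_def)
    have "poly ?r (X s) = (y * poly p y - z * poly p z) / (y - z)
        - (1 / 2) * ((y\<^sup>2 - z\<^sup>2) / (y - z) * ((poly p y - poly p z) / (y - z)))"
      by (simp add: Dop_eq[OF adm that] div_diff_def y_def z_def poly_monom)
    also have "(y\<^sup>2 - z\<^sup>2) / (y - z) = y + z"
      using nz by (simp add: power2_eq_square square_diff_square_factored)
    also have "(y * poly p y - z * poly p z) / (y - z)
        - (1 / 2) * ((y + z) * ((poly p y - poly p z) / (y - z))) = (poly p y + poly p z) / 2"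
      using nz by (simp add: divide_simps) (simp add: algebra_simps)
    finally show ?thesis
      by (simp add: half_sum_def y_def z_def)
  qed
  then show ?thesis
    using poly_eq_on_infinite_image[OF inf] by (metis (no_types, lifting))
qed

lemma Sop_eq:
  assumes "admissible h U X" and "s \<in> U"
  shows "poly (Sop h U X p) (X s) = half_sum h X p s"
  using theI'[OF Sop_ex1[OF assms(1)]] assms(2) unfolding Sop_def by blast

subsection \<open>Functionals on polynomials\<close>

text \<open>With the inductive limit topology every linear functional on the space of polynomials is
  continuous, so the continuous dual is the algebraic dual.\<close>

definition poly_dual :: "(complex poly \<Rightarrow> complex) set" where
  "poly_dual = {u. Vector_Spaces.linear smult (*) u}"

definition mult_functional ::
    "complex poly \<Rightarrow> (complex poly \<Rightarrow> complex) \<Rightarrow> complex poly \<Rightarrow> complex" where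
  "mult_functional p0 u = (\<lambda>p. u (p0 * p))"

definition D_functional ::
    "complex \<Rightarrow> complex set \<Rightarrow> (complex \<Rightarrow> complex) \<Rightarrow>
     (complex poly \<Rightarrow> complex) \<Rightarrow> complex poly \<Rightarrow> complex" where
  "D_functional h U X u = (\<lambda>p. - u (Dop h U X p))"

definition S_functional ::
    "complex \<Rightarrow> complex set \<Rightarrow> (complex \<Rightarrow> complex) \<Rightarrow>
     (complex poly \<Rightarrow> complex) \<Rightarrow> complex poly \<Rightarrow> complex" where
  "S_functional h U X u = (\<lambda>p. u (Sop h U X p))"

subsection \<open>Orthogonality, regularity, classical functionals\<close>

definition orthogonal_family ::
    "nat set \<Rightarrow> (complex poly \<Rightarrow> complex) \<Rightarrow> (nat \<Rightarrow> complex poly) \<Rightarrow> bool" where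
  "orthogonal_family I u P \<longleftrightarrow>
     (\<forall>n\<in>I. degree (P n) = n) \<and>
     (\<forall>n\<in>I. \<forall>m\<in>I. m < n \<longrightarrow> u (P n * P m) = 0) \<and>
     (\<forall>n\<in>I. u ((P n)\<^sup>2) \<noteq> 0)"

definition monic_orthogonal_family ::
    "nat set \<Rightarrow> (complex poly \<Rightarrow> complex) \<Rightarrow> (nat \<Rightarrow> complex poly) \<Rightarrow> bool" where
  "monic_orthogonal_family I u P \<longleftrightarrow>
     orthogonal_family I u P \<and> (\<forall>n\<in>I. lead_coeff (P n) = 1)"

definition regular :: "(complex poly \<Rightarrow> complex) \<Rightarrow> bool" where
  "regular u \<longleftrightarrow> (\<exists>P. orthogonal_family UNIV u P)"

text \<open>\<open>regular_upto M\<close> is regularity of order \<open>M + 1\<close>.\<close>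

definition regular_upto :: "nat \<Rightarrow> (complex poly \<Rightarrow> complex) \<Rightarrow> bool" where
  "regular_upto M u \<longleftrightarrow> (\<exists>P. orthogonal_family {0..M} u P)"

definition classical ::
    "complex \<Rightarrow> complex set \<Rightarrow> (complex \<Rightarrow> complex) \<Rightarrow> (complex poly \<Rightarrow> complex) \<Rightarrow> bool" where
  "classical h U X u \<longleftrightarrow>
     (regular u \<or> (\<exists>M. M + 1 \<ge> 3 \<and> regular_upto M u)) \<and>
     (\<exists>\<phi> \<psi>. degree \<phi> \<le> 2 \<and> degree \<psi> \<le> 1 \<and> \<not> (\<phi> = 0 \<and> \<psi> = 0) \<and>
        D_functional h U X (mult_functional \<phi> u) = S_functional h U X (mult_functional \<psi> u))"

subsection \<open>Branches\<close>

definition branch_constants ::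
    "complex \<Rightarrow> complex set \<Rightarrow> (complex \<Rightarrow> complex) \<Rightarrow> complex \<Rightarrow> complex \<Rightarrow> bool" where
  "branch_constants h U X \<eta> \<beta> \<longleftrightarrow>
     (\<forall>s\<in>U. shift_up h X s + shift_down h X s = \<eta> * X s + \<beta>)"

text \<open>In the \<open>q\<close>-exponential branch \<open>r\<close> stands for the chosen square root \<open>q\<^sup>1\<^sup>/\<^sup>2\<close>,
  so that \<open>q\<^sup>n\<^sup>/\<^sup>2\<close> is \<open>r ^ n\<close>.  The condition \<open>q \<noteq> 0\<close> is explicit because
  \<open>inverse 0 = 0\<close>.\<close>

definition q_exponential_branch :: "complex \<Rightarrow> complex \<Rightarrow> complex \<Rightarrow> bool" where
  "q_exponential_branch \<eta> q r \<longleftrightarrow>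
     \<eta> \<notin> {0, 2, -2} \<and> q \<noteq> 0 \<and> q + inverse q = \<eta>\<^sup>2 - 2 \<and> r\<^sup>2 = q \<and> r + inverse r = \<eta>"

definition root_of_unity :: "complex \<Rightarrow> bool" where
  "root_of_unity q \<longleftrightarrow> (\<exists>n\<ge>1. q ^ n = 1)"

text \<open>The case \<open>\<eta> = 2\<close> is the ordinary quadratic half-step branch, where \<open>r\<close> plays no role;
  the other case is only used in the \<open>q\<close>-exponential branch.\<close>

definition gamma_coeff :: "complex \<Rightarrow> complex \<Rightarrow> nat \<Rightarrow> complex" where
  "gamma_coeff \<eta> r n =
     (if \<eta> = 2 then of_nat n else (r ^ n - inverse (r ^ n)) / (r - inverse r))"

definition alpha_coeff :: "complex \<Rightarrow> nat \<Rightarrow> complex" where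
  "alpha_coeff r n = (r ^ n + inverse (r ^ n)) / 2"

definition d_coeff ::
    "complex \<Rightarrow> complex \<Rightarrow> complex poly \<Rightarrow> complex poly \<Rightarrow> nat \<Rightarrow> complex" where
  "d_coeff \<eta> r \<phi> \<psi> n =
     (if \<eta> = 2 then coeff \<phi> 2 * of_nat n + coeff \<psi> 1
      else coeff \<phi> 2 * gamma_coeff \<eta> r n + coeff \<psi> 1 * alpha_coeff r n)"

end

theory Submission
  imports Defs
begin

text \<open>
  Write \<open>u\<close> for the given functional, \<open>v\<close> for the derived one, and \<open>\<alpha> = \<eta> / 2\<close>,
  \<open>U\<^sub>1 = S\<^sup>2 x - x\<close>, \<open>\<chi> = \<alpha> \<phi> + U\<^sub>1 \<psi>\<close>. The functional equation says that \<open>u (\<phi> D f + \<psi> S f) = 0\<close>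
  for all \<open>f\<close>. The test polynomials \<open>f = \<alpha> S p - U\<^sub>1 D p\<close> and \<open>f = \<alpha> U\<^sub>2 D p - U\<^sub>1 S p\<close> turn it
  into \<open>v (D p) = \<alpha> u (\<psi> p)\<close> and \<open>v (S p) = - \<alpha> u (\<chi> p)\<close>. By the product rules, whenever
  \<open>S k = - D g\<close> one gets \<open>v ((S g + U\<^sub>2 D k) D p) = \<alpha> u ((\<psi> g - \<chi> k) p)\<close>. Every \<open>f\<close> of degree \<open>n\<close> is
  of the form \<open>S g + U\<^sub>2 D k\<close>, and the coefficient of \<open>x\<^bsup>n+1\<^esup>\<close> in \<open>\<alpha> (\<psi> g - \<chi> k)\<close> is \<open>\<alpha> d\<^sub>n\<close> times
  the leading coefficient of \<open>f\<close>; hence the \<open>D P\<^sub>n\<^sub>+\<^sub>1\<close> are orthogonal for \<open>v\<close>, with nonzero norms when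
  \<open>d\<^sub>n \<noteq> 0\<close>. In the infinite case \<open>d\<^sub>n = 0\<close> would force \<open>D P\<^sub>n\<^sub>+\<^sub>1 v = 0\<close>; but if \<open>Q v = 0\<close> with
  \<open>Q \<noteq> 0\<close>, then the polynomial \<open>Q(Y) Q(Z)\<close> times \<open>\<psi>\<close> and times \<open>\<chi>\<close> annihilates the regular functional
  \<open>u\<close>, so that \<open>\<phi> = \<psi> = 0\<close>.
\<close>


section \<open>Leading coefficients of products and graded bases of polynomials\<close>

lemma coeff_mult_le_degrees:
  fixes p q :: "'a::comm_semiring_0 poly"
  assumes "degree p \<le> m" and "degree q \<le> n"
  shows "coeff (p * q) (m + n) = coeff p m * coeff q n"
proof -
  have "coeff p i * coeff q (m + n - i) = (if i = m then coeff p m * coeff q n else 0)"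
    if "i \<le> m + n" for i
  proof (cases i m rule: linorder_cases)
    case less
    then have "coeff q (m + n - i) = 0"
      using assms(2) by (intro coeff_eq_0) linarith
    with less show ?thesis by simp
  next
    case greater
    then have "coeff p i = 0"
      using assms(1) by (intro coeff_eq_0) linarith
    with greater show ?thesis by simp
  qed auto
  then have "coeff (p * q) (m + n) = (\<Sum>i\<le>m + n. if i = m then coeff p m * coeff q n else 0)"
    unfolding coeff_mult by (intro sum.cong) auto
  then show ?thesis by simp
qed

lemma degree_mult_le_degrees:
  fixes p q :: "'a::comm_semiring_0 poly"
  assumes "degree p \<le> m" and "degree q \<le> n"
  shows "degree (p * q) \<le> m + n"
  using degree_mult_le[of p q] assms by linarith

lemma degree_le_minus_leading:
  fixes p :: "'a::comm_ring_1 poly"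
  assumes "degree p \<le> Suc n" and "coeff p (Suc n) = 0"
  shows "degree p \<le> n"
  using assms by (metis degree_le coeff_eq_0 le_antisym not_less_eq_eq linorder_not_less)

text \<open>The \<open>P m\<close> have every degree below \<open>k\<close>, so subtracting
  multiples of them removes the coefficients of \<open>w\<close> from the top down. Nonvanishing is
  a separate premise because the zero polynomial also has degree 0.\<close>

lemma poly_basis_induct:
  fixes w :: "'a::field poly" and P :: "nat \<Rightarrow> 'a poly"
  assumes "degree w < k"
    and deg: "\<And>m. m < k \<Longrightarrow> degree (P m) = m" and nz: "\<And>m. m < k \<Longrightarrow> P m \<noteq> 0"
    and zero: "R 0"
    and add: "\<And>m c v. m < k \<Longrightarrow> R v \<Longrightarrow> R (smult c (P m) + v)"
  shows "R w"
proof -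
  have "R w" if "j \<le> k" "\<And>i. i \<ge> j \<Longrightarrow> coeff w i = 0" for j w
    using that
  proof (induction j arbitrary: w)
    case 0
    then have "w = 0" by (simp add: poly_eq_iff)
    with zero show ?case by simp
  next
    case (Suc j)
    have dj: "degree (P j) = j" and lj: "coeff (P j) j \<noteq> 0"
      using deg[of j] nz[of j] Suc.prems(1) leading_coeff_neq_0[of "P j"] by auto
    define c where "c = coeff w j / coeff (P j) j"
    have "coeff (w - smult c (P j)) i = 0" if "i \<ge> j" for i
    proof (cases "i = j")
      case True
      then show ?thesis using lj by (simp add: c_def)
    next
      case False
      then have "coeff w i = 0" "coeff (P j) i = 0"
        using that Suc.prems(2) dj by (auto intro: coeff_eq_0)
      then show ?thesis by simp
    qed
    then have "R (w - smult c (P j))"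
      using Suc.IH[of "w - smult c (P j)"] Suc.prems(1) by simp
    from add[OF _ this, of j c] Suc.prems(1) show ?case by simp
  qed
  from this[of k w] assms(1) show ?thesis by (simp add: coeff_eq_0)
qed

subsection \<open>Functionals and orthogonality\<close>

lemma poly_dual_iff:
  "u \<in> poly_dual \<longleftrightarrow> (\<forall>p q. u (p + q) = u p + u q) \<and> (\<forall>c p. u (smult c p) = c * u p)"
proof -
  have "vector_space (smult :: complex \<Rightarrow> complex poly \<Rightarrow> _)" "vector_space ((*) :: complex \<Rightarrow> _)"
    by unfold_locales (auto simp: smult_add_right smult_add_left algebra_simps)
  then show ?thesis
    by (auto simp: poly_dual_def Vector_Spaces.linear_iff)
qed

lemma poly_dual_simps:
  assumes "u \<in> poly_dual"
  shows "u (p + q) = u p + u q" "u (smult c p) = c * u p" "u 0 = 0" "u (- p) = - u p"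
    "u (p - q) = u p - u q"
proof -
  show add: "u (p + q) = u p + u q" and sc: "u (smult c p) = c * u p" for p q c
    using assms by (auto simp: poly_dual_iff)
  show "u 0 = 0" using sc[of 0 0] by simp
  show minus: "u (- p) = - u p" for p using sc[of "-1" p] by simp
  show "u (p - q) = u p - u q" using add[of p "- q"] minus[of q] by simp
qed

lemma orthogonal_family_lower_degree:
  assumes "u \<in> poly_dual" and "orthogonal_family I u P" and "{..n} \<subseteq> I" and "degree w < n"
  shows "u (P n * w) = 0"
proof -
  have I: "m \<in> I" "n \<in> I" if "m < n" for m
    using assms(3) that by auto
  have orth: "u (P n * P m) = 0" if "m < n" for m
    using assms(2) I that by (simp add: orthogonal_family_def)
  have deg: "degree (P m) = m" if "m < n" for m
    using assms(2) I that by (simp add: orthogonal_family_def)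
  have nz: "P m \<noteq> 0" if "m < n" for m
    using assms(2) I[OF that] poly_dual_simps(3)[OF assms(1)]
    by (auto simp: orthogonal_family_def power2_eq_square)
  show ?thesis
    by (rule poly_basis_induct[OF assms(4), of P "\<lambda>w. u (P n * w) = 0"])
      (simp_all add: deg nz orth distrib_left poly_dual_simps[OF assms(1)])
qed

text \<open>Subtracting \<open>coeff w n\<close> times the monic \<open>P n\<close> cancels the top
  coefficient, and \<open>P n\<close> is orthogonal to what remains.\<close>

lemma monic_orthogonal_family_same_degree:
  assumes u: "u \<in> poly_dual" and "monic_orthogonal_family I u P" and I: "{..n} \<subseteq> I"
    and "degree w \<le> n"
  shows "u (P n * w) = coeff w n * u ((P n)\<^sup>2)"
proof -
  have orth: "orthogonal_family I u P" and P: "degree (P n) = n" "coeff (P n) n = 1"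
    using assms by (auto simp: monic_orthogonal_family_def orthogonal_family_def)
  let ?v = "w - smult (coeff w n) (P n)"
  have "u (P n * ?v) = 0"
  \<comment> \<open>For \<open>n = 0\<close> no degree lies below \<open>n\<close>; there the
    difference itself is zero.\<close>
  proof (cases n)
    case 0
    then have "?v = 0"
      using assms(4) P by (metis coeff_diff coeff_smult degree_0_id degree_diff_le degree_smult_le
        diff_self le_zero_eq mult.right_neutral of_nat_0 pCons_0_0)
    then show ?thesis by (metis mult_zero_right poly_dual_simps(3)[OF u])
  next
    case (Suc m)
    have "degree ?v \<le> Suc m"
      using assms(4) P Suc by (intro degree_diff_le order.trans[OF degree_smult_le]) auto
    then have "degree ?v < n"
      using degree_le_minus_leading[of ?v m] P Suc by simp
    then show ?thesis
      by (rule orthogonal_family_lower_degree[OF u orth I])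
  qed
  then show ?thesis
    by (simp add: poly_dual_simps[OF u] algebra_simps power2_eq_square)
qed

text \<open>Pairing a nonzero \<open>w\<close> with \<open>P (degree w)\<close> gives its leading
  coefficient times a nonzero norm.\<close>

lemma orthogonal_family_regular_mult_zero:
  assumes u: "u \<in> poly_dual" and "monic_orthogonal_family UNIV u P" and "\<And>p. u (w * p) = 0"
  shows "w = 0"
proof (rule ccontr)
  assume "w \<noteq> 0"
  moreover have "u (P (degree w) * w) = 0"
    using assms(3)[of "P (degree w)"] by (simp add: mult.commute)
  ultimately show False
    using monic_orthogonal_family_same_degree[OF assms(1,2), of "degree w" w] assms(2)
    by (auto simp: monic_orthogonal_family_def orthogonal_family_def)
qed

subsection \<open>Operator calculus on a half-step lattice\<close>

locale half_step_lattice =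
  fixes h \<eta> \<beta> :: complex and U :: "complex set" and X :: "complex \<Rightarrow> complex"
  assumes inv: "half_step_invariant h U"
    and adm: "admissible h U X"
    and branch: "branch_constants h U X \<eta> \<beta>"
    and eta_nz: "\<eta> \<noteq> 0"
begin

abbreviation "D \<equiv> Dop h U X"
abbreviation "S \<equiv> Sop h U X"

definition \<alpha> :: complex where "\<alpha> = \<eta> / 2"
text \<open>Having \<alpha> as a constant polynomial turns the operator identities into pure ring
  identities, within reach of \<open>algebra\<close>.\<close>

definition \<kappa> :: "complex poly" where "\<kappa> = [:\<alpha>:]"
definition U1 :: "complex poly" where "U1 = [:(\<alpha> + 1) * \<beta> / 2, \<alpha>\<^sup>2 - 1:]"
definition U2 :: "complex poly" where "U2 = S ([:0, 1:]\<^sup>2) - (S [:0, 1:])\<^sup>2"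

lemma alpha_nz: "\<alpha> \<noteq> 0"
  using eta_nz by (simp add: \<alpha>_def)

lemma kappa_mult: "\<kappa> * p = smult \<alpha> p"
  by (simp add: \<kappa>_def)

section \<open>Values at neighbouring lattice points\<close>

definition up :: "complex \<Rightarrow> complex" where "up s = X (s + h / 2)"
definition dn :: "complex \<Rightarrow> complex" where "dn s = X (s - h / 2)"
definition up2 :: "complex \<Rightarrow> complex" where "up2 s = X (s + h)"
definition dn2 :: "complex \<Rightarrow> complex" where "dn2 s = X (s - h)"

text \<open>\<open>X\<close> takes infinitely many values on \<open>U\<close>, so every operator
  identity below can be checked pointwise.\<close>

lemma lattice_poly_eqI:
  assumes "\<And>s. s \<in> U \<Longrightarrow> poly p (X s) = poly q (X s)"
  shows "p = q"
  using poly_eq_on_infinite_image[of X U p q] adm assms by (auto simp: admissible_def)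

lemma step_nz: "s \<in> U \<Longrightarrow> up s - dn s \<noteq> 0"
  using adm by (auto simp: admissible_def parametrising_def shift_up_def shift_down_def up_def dn_def)

lemma D_at: "s \<in> U \<Longrightarrow> poly (D p) (X s) = (poly p (up s) - poly p (dn s)) / (up s - dn s)"
  using Dop_eq[OF adm] by (simp add: div_diff_def shift_up_def shift_down_def up_def dn_def)

lemma S_at: "s \<in> U \<Longrightarrow> poly (S p) (X s) = (poly p (up s) + poly p (dn s)) / 2"
  using Sop_eq[OF adm] by (simp add: half_sum_def shift_up_def shift_down_def up_def dn_def)

lemma branch_at: "s \<in> U \<Longrightarrow> up s + dn s = \<eta> * X s + \<beta>"
  using branch by (auto simp: branch_constants_def shift_up_def shift_down_def up_def dn_def)

lemma shift_up_facts:
  assumes "s \<in> U"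
  shows "s + h / 2 \<in> U" "X (s + h / 2) = up s" "up (s + h / 2) = up2 s" "dn (s + h / 2) = X s"
  using inv assms by (auto simp: half_step_invariant_def up_def dn_def up2_def add.assoc)

lemma shift_down_facts:
  assumes "s \<in> U"
  shows "s - h / 2 \<in> U" "X (s - h / 2) = dn s" "up (s - h / 2) = X s" "dn (s - h / 2) = dn2 s"
  using inv assms by (auto simp: half_step_invariant_def up_def dn_def dn2_def diff_diff_eq)

text \<open>The point \<open>up s\<close> is itself a lattice value, with neighbours
  \<open>up2 s\<close> and \<open>X s\<close>; the formulas for \<open>D\<close>, \<open>S\<close>
  and the branch are read off at \<open>s + h / 2\<close>.\<close>

lemma up_at:
  assumes "s \<in> U"
  shows "poly (D p) (up s) = (poly p (up2 s) - poly p (X s)) / (up2 s - X s)"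
    and "poly (S p) (up s) = (poly p (up2 s) + poly p (X s)) / 2"
    and "up2 s - X s \<noteq> 0" and "up2 s + X s = \<eta> * up s + \<beta>"
  using D_at[OF shift_up_facts(1)[OF assms], of p] S_at[OF shift_up_facts(1)[OF assms], of p]
    step_nz[OF shift_up_facts(1)[OF assms]] branch_at[OF shift_up_facts(1)[OF assms]]
  unfolding shift_up_facts(2-)[OF assms] .

lemma down_at:
  assumes "s \<in> U"
  shows "poly (D p) (dn s) = (poly p (X s) - poly p (dn2 s)) / (X s - dn2 s)"
    and "poly (S p) (dn s) = (poly p (X s) + poly p (dn2 s)) / 2"
    and "X s - dn2 s \<noteq> 0" and "X s + dn2 s = \<eta> * dn s + \<beta>"
  using D_at[OF shift_down_facts(1)[OF assms], of p] S_at[OF shift_down_facts(1)[OF assms], of p]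
    step_nz[OF shift_down_facts(1)[OF assms]] branch_at[OF shift_down_facts(1)[OF assms]]
  unfolding shift_down_facts(2-)[OF assms] .

section \<open>Linearity and product rules\<close>

lemma D_add: "D (p + q) = D p + D q"
  by (rule lattice_poly_eqI) (simp add: D_at add_divide_distrib[symmetric] algebra_simps)

lemma S_add: "S (p + q) = S p + S q"
  by (rule lattice_poly_eqI) (simp add: S_at field_simps)

lemma D_const: "D [:c:] = 0"
  by (rule lattice_poly_eqI) (simp add: D_at)

lemma S_const: "S [:c:] = [:c:]"
  by (rule lattice_poly_eqI) (simp add: S_at)

lemma D_mult: "D (p * q) = D p * S q + S p * D q"
proof (rule lattice_poly_eqI)
  fix s assume s: "s \<in> U"
  show "poly (D (p * q)) (X s) = poly (D p * S q + S p * D q) (X s)"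
    using step_nz[OF s] by (simp add: s D_at S_at divide_simps) (simp add: algebra_simps)
qed

text \<open>The mean of two squares minus the square of their mean is a quarter of the squared
  difference.\<close>

lemma U2_at: "s \<in> U \<Longrightarrow> poly U2 (X s) = (up s - dn s)\<^sup>2 / 4"
  by (simp add: U2_def S_at power2_eq_square field_simps)

lemma U2_up: "s \<in> U \<Longrightarrow> poly U2 (up s) = (up2 s - X s)\<^sup>2 / 4"
  using U2_at[of "s + h / 2"] by (simp add: shift_up_facts)

lemma U2_down: "s \<in> U \<Longrightarrow> poly U2 (dn s) = (X s - dn2 s)\<^sup>2 / 4"
  using U2_at[of "s - h / 2"] by (simp add: shift_down_facts)

text \<open>Write the values at \<open>up s\<close> and \<open>dn s\<close> as mean plus or minus
  half difference; the product of the two half differences is \<open>U2 * D p * D q\<close> by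
  \<open>U2_at\<close>.\<close>

lemma S_mult: "S (p * q) = U2 * D p * D q + S p * S q"
proof (rule lattice_poly_eqI)
  fix s assume s: "s \<in> U"
  show "poly (S (p * q)) (X s) = poly (U2 * D p * D q + S p * S q) (X s)"
    using step_nz[OF s] by (simp add: s D_at S_at U2_at power2_eq_square) (simp add: field_simps)
qed

lemma D_smult: "D (smult c p) = smult c (D p)"
  using D_mult[of "[:c:]" p] by (simp add: D_const S_const)

lemma S_smult: "S (smult c p) = smult c (S p)"
  using S_mult[of "[:c:]" p] by (simp add: D_const S_const)

lemma D_zero [simp]: "D 0 = 0" and S_zero [simp]: "S 0 = 0"
  using D_const[of 0] S_const[of 0] by simp_all

lemma D_minus: "D (- p) = - D p" and S_minus: "S (- p) = - S p"
  using D_smult[of "-1" p] S_smult[of "-1" p] by simp_all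

lemma D_diff: "D (p - q) = D p - D q" and S_diff: "S (p - q) = S p - S q"
  using D_add[of p "- q"] S_add[of p "- q"] by (simp_all add: D_minus S_minus)

lemma kappa_const: "D \<kappa> = 0" "S \<kappa> = \<kappa>"
  by (simp_all add: \<kappa>_def D_const S_const)

lemma D_var: "D [:0, 1:] = 1"
  by (rule lattice_poly_eqI) (use step_nz in \<open>auto simp: D_at\<close>)

lemma S_var: "S [:0, 1:] = [:\<beta> / 2, \<alpha>:]"
  by (rule lattice_poly_eqI) (simp add: S_at branch_at \<alpha>_def add_divide_distrib mult.commute)

lemma D_pCons: "D (pCons c p) = S p + [:\<beta> / 2, \<alpha>:] * D p"
proof -
  have "pCons c p = [:c:] + [:0, 1:] * p" by simp
  then show ?thesis by (simp only: D_add D_mult D_const D_var S_var) simp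
qed

lemma S_pCons: "S (pCons c p) = [:c:] + U2 * D p + [:\<beta> / 2, \<alpha>:] * S p"
proof -
  have "pCons c p = [:c:] + [:0, 1:] * p" by simp
  then show ?thesis by (simp only: S_add S_mult S_const D_var S_var) simp
qed

section \<open>Full steps and the commutation of \<open>D\<close> and \<open>S\<close>\<close>

lemma D_U1: "D U1 = \<kappa>\<^sup>2 - 1"
  by (simp add: U1_def D_pCons S_const D_const \<kappa>_def power2_eq_square one_pCons)

lemma S_U1: "S U1 = \<kappa> * U1"
  by (simp add: U1_def S_pCons S_const D_const \<kappa>_def power2_eq_square field_simps)

lemma U1_at:
  assumes s: "s \<in> U"
  shows "poly U1 (X s) = (up2 s + dn2 s - 2 * X s) / 4"
proof -
  have full: "up2 s = \<eta> * up s + \<beta> - X s" "dn2 s = \<eta> * dn s + \<beta> - X s"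
    using up_at(4)[OF s] down_at(4)[OF s] by (simp_all add: algebra_simps)
  have "up2 s + dn2 s - 2 * X s = \<eta> * (up s + dn s) + 2 * \<beta> - 4 * X s"
    unfolding full by (simp add: algebra_simps)
  also have "\<dots> = \<eta> * (\<eta> * X s + \<beta>) + 2 * \<beta> - 4 * X s"
    by (simp only: branch_at[OF s])
  finally have *: "up2 s + dn2 s - 2 * X s = \<eta> * (\<eta> * X s + \<beta>) + 2 * \<beta> - 4 * X s" .
  show ?thesis
    unfolding * by (simp add: U1_def \<alpha>_def power2_eq_square field_simps)
qed

text \<open>The two full steps have half difference and half sum determined by the branch relation
  at \<open>s + h / 2\<close>, \<open>s - h / 2\<close> and \<open>s\<close>. This eliminates
  \<open>up2 s\<close> and \<open>dn2 s\<close> from the later identities.\<close>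

lemma full_step:
  assumes s: "s \<in> U"
  shows "up2 s = X s + (\<alpha> * (up s - dn s) + 2 * poly U1 (X s))"
    and "dn2 s = X s - (\<alpha> * (up s - dn s) - 2 * poly U1 (X s))"
proof -
  have full: "up2 s = \<eta> * up s + \<beta> - X s" "dn2 s = \<eta> * dn s + \<beta> - X s"
    using up_at(4)[OF s] down_at(4)[OF s] by (simp_all add: algebra_simps)
  have "up2 s - dn2 s = \<eta> * (up s - dn s)"
    unfolding full by (simp add: algebra_simps)
  then have "up2 s - dn2 s = 2 * (\<alpha> * (up s - dn s))"
    by (simp add: \<alpha>_def)
  then have *: "\<alpha> * (up s - dn s) = (up2 s - dn2 s) / 2"
    by (simp add: \<alpha>_def)
  show "up2 s = X s + (\<alpha> * (up s - dn s) + 2 * poly U1 (X s))"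
    and "dn2 s = X s - (\<alpha> * (up s - dn s) - 2 * poly U1 (X s))"
    unfolding * U1_at[OF s] by (simp_all add: field_simps)
qed

lemma D_U2: "D U2 = 2 * \<kappa> * U1"
proof (rule lattice_poly_eqI)
  fix s assume s: "s \<in> U"
  show "poly (D U2) (X s) = poly (2 * \<kappa> * U1) (X s)"
    using step_nz[OF s]
    by (simp add: s D_at U2_up U2_down full_step \<kappa>_def)
      (simp add: field_simps power2_eq_square)
qed

lemma S_U2: "S U2 = \<kappa>\<^sup>2 * U2 + U1\<^sup>2"
proof (rule lattice_poly_eqI)
  fix s assume s: "s \<in> U"
  show "poly (S U2) (X s) = poly (\<kappa>\<^sup>2 * U2 + U1\<^sup>2) (X s)"
    by (simp add: s S_at U2_at U2_up U2_down full_step \<kappa>_def)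
      (simp add: field_simps power2_eq_square)
qed

text \<open>A division-free form of the divided differences at \<open>up s\<close> and
  \<open>dn s\<close>, so that only the denominator \<open>up s - dn s\<close> remains when
  \<open>D\<close> and \<open>S\<close> are iterated.\<close>

lemma full_step_poly:
  assumes s: "s \<in> U"
  shows "poly p (up2 s) = poly p (X s)
      + poly (D p) (up s) * (\<alpha> * (up s - dn s) + 2 * poly U1 (X s))"
    and "poly p (dn2 s) = poly p (X s)
      - poly (D p) (dn s) * (\<alpha> * (up s - dn s) - 2 * poly U1 (X s))"
proof -
  have "poly (D p) (up s) * (up2 s - X s) = poly p (up2 s) - poly p (X s)"
    using up_at(3)[OF s] by (simp add: up_at(1)[OF s])
  moreover have "poly (D p) (dn s) * (X s - dn2 s) = poly p (X s) - poly p (dn2 s)"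
    using down_at(3)[OF s] by (simp add: down_at(1)[OF s])
  moreover have "up2 s - X s = \<alpha> * (up s - dn s) + 2 * poly U1 (X s)"
    "X s - dn2 s = \<alpha> * (up s - dn s) - 2 * poly U1 (X s)"
    using full_step[OF s] by simp_all
  ultimately show "poly p (up2 s) = poly p (X s)
      + poly (D p) (up s) * (\<alpha> * (up s - dn s) + 2 * poly U1 (X s))"
    and "poly p (dn2 s) = poly p (X s)
      - poly (D p) (dn s) * (\<alpha> * (up s - dn s) - 2 * poly U1 (X s))"
    by simp_all
qed

text \<open>By \<open>full_step_poly\<close>, \<open>S p\<close> takes at each neighbour the value
  of \<open>p\<close> at \<open>X s\<close> plus a correction in \<open>D p\<close>. The common
  value cancels here and survives as the summand \<open>p\<close> in \<open>S_S\<close>.\<close>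

lemma D_S: "D (S p) = \<kappa> * S (D p) + U1 * D (D p)"
proof (rule lattice_poly_eqI)
  fix s assume s: "s \<in> U"
  show "poly (D (S p)) (X s) = poly (\<kappa> * S (D p) + U1 * D (D p)) (X s)"
    using step_nz[OF s]
    by (simp add: s D_at S_at up_at(2) down_at(2) full_step_poly \<kappa>_def)
      (simp add: field_simps)
qed

lemma S_S: "S (S p) = \<kappa> * U2 * D (D p) + U1 * S (D p) + p"
proof (rule lattice_poly_eqI)
  fix s assume s: "s \<in> U"
  show "poly (S (S p)) (X s) = poly (\<kappa> * U2 * D (D p) + U1 * S (D p) + p) (X s)"
    using step_nz[OF s]
    by (simp add: s D_at S_at up_at(2) down_at(2) U2_at full_step_poly \<kappa>_def)
      (simp add: field_simps power2_eq_square)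
qed

text \<open>The polynomial in \<open>X\<close> whose value is \<open>p(Y) p(Z)\<close>.\<close>

definition lattice_norm :: "complex poly \<Rightarrow> complex poly" where
  "lattice_norm p = (S p)\<^sup>2 - U2 * (D p)\<^sup>2"

lemma lattice_norm_at:
  assumes s: "s \<in> U"
  shows "poly (lattice_norm p) (X s) = poly p (up s) * poly p (dn s)"
  using step_nz[OF s]
  by (simp add: lattice_norm_def s D_at S_at U2_at power2_eq_square) (simp add: field_simps)

lemma lattice_norm_up: "s \<in> U \<Longrightarrow> poly (lattice_norm p) (up s) = poly p (up2 s) * poly p (X s)"
  using lattice_norm_at[of "s + h / 2"] by (simp add: shift_up_facts)

lemma lattice_norm_down: "s \<in> U \<Longrightarrow> poly (lattice_norm p) (dn s) = poly p (X s) * poly p (dn2 s)"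
  using lattice_norm_at[of "s - h / 2"] by (simp add: shift_down_facts)

text \<open>The values of the norm at both neighbours share the factor \<open>poly p (X s)\<close>;
  what is left is the mean of \<open>p\<close> over the two full steps, which \<open>S (S p)\<close>
  determines.\<close>

lemma S_lattice_norm: "S (lattice_norm p) = p * (2 * S (S p) - p)"
proof (rule lattice_poly_eqI)
  fix s assume s: "s \<in> U"
  show "poly (S (lattice_norm p)) (X s) = poly (p * (2 * S (S p) - p)) (X s)"
    by (simp add: s S_at up_at(2) down_at(2) lattice_norm_up lattice_norm_down)
      (simp add: field_simps)
qed

lemma D_lattice_norm: "D (lattice_norm p) = p * (2 * D (S p))"
proof (rule lattice_poly_eqI)
  fix s assume s: "s \<in> U"
  show "poly (D (lattice_norm p)) (X s) = poly (p * (2 * D (S p))) (X s)"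
    using step_nz[OF s]
    by (simp add: s D_at up_at(2) down_at(2) lattice_norm_up lattice_norm_down)
      (simp add: field_simps)
qed

section \<open>Degrees of \<open>D p\<close> and \<open>U2\<close>\<close>

lemma degree_D: "degree (D p) \<le> degree p - 1"
proof (cases "degree p \<ge> 1")
  case True
  then obtain r where r: "degree r \<le> degree p - 1" "\<forall>s\<in>U. div_diff h X p s = poly r (X s)"
    using adm by (auto simp: admissible_def)
  have "D p = r"
    by (rule lattice_poly_eqI) (simp add: Dop_eq[OF adm] r)
  with r show ?thesis by simp
next
  case False
  then have "degree p = 0" by simp
  then obtain c where "p = [:c:]" by (rule degree_eq_zeroE)
  then show ?thesis by (simp add: D_const)
qed

text \<open>Admissibility bounds degrees only for \<open>D\<close>; the product rule for x times x^2
  expresses \<open>S\<close> of x^2 through \<open>D\<close>.\<close>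

lemma degree_U2: "degree U2 \<le> 2"
proof -
  have "D ([:0, 1:] * [:0, 1:]\<^sup>2) = S ([:0, 1:]\<^sup>2) + [:\<beta> / 2, \<alpha>:] * D ([:0, 1:]\<^sup>2)"
    by (simp only: D_mult D_var S_var mult_1)
  then have "U2 = D ([:0, 1:] * [:0, 1:]\<^sup>2) - [:\<beta> / 2, \<alpha>:] * D ([:0, 1:]\<^sup>2) - [:\<beta> / 2, \<alpha>:]\<^sup>2"
    by (simp add: U2_def S_var)
  moreover have "degree (D ([:0, 1:] * [:0, 1:]\<^sup>2)) \<le> 2"
    using degree_D[of "[:0, 1:] * [:0, 1:]\<^sup>2"] by (simp add: degree_mult_eq degree_power_eq)
  moreover have "degree (D ([:0, 1:]\<^sup>2)) \<le> 1"
    using degree_D[of "[:0, 1:]\<^sup>2"] by (simp add: degree_power_eq)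
  then have "degree ([:\<beta> / 2, \<alpha>:] * D ([:0, 1:]\<^sup>2)) \<le> 1 + 1"
    by (intro degree_mult_le_degrees) auto
  moreover have "degree ([:\<beta> / 2, \<alpha>:]\<^sup>2) \<le> 1 + 1"
    unfolding power2_eq_square by (intro degree_mult_le_degrees) auto
  ultimately show ?thesis
    by (simp add: degree_diff_le)
qed

text \<open>Compare the coefficients of x in \<open>D_U2\<close>; \<alpha> is nonzero and
  cancels.\<close>

lemma coeff_U2: "coeff U2 2 = \<alpha>\<^sup>2 - 1"
proof -
  obtain a b c where U2: "U2 = [:c, b, a:]"
  proof
    show "U2 = [:coeff U2 0, coeff U2 1, coeff U2 2:]"
    proof (rule poly_eqI)
      fix n
      show "coeff U2 n = coeff [:coeff U2 0, coeff U2 1, coeff U2 2:] n"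
        using degree_U2 coeff_eq_0[of U2 n]
        by (auto simp: coeff_pCons numeral_2_eq_2 split: nat.splits)
    qed
  qed
  have "coeff (D U2) 1 = 2 * \<alpha> * a"
    by (simp add: U2 D_pCons S_pCons D_const S_const)
  moreover have "coeff U1 1 = \<alpha>\<^sup>2 - 1"
    by (simp add: U1_def)
  then have "coeff (D U2) 1 = 2 * \<alpha> * (\<alpha>\<^sup>2 - 1)"
    by (simp only: D_U2 mult.assoc mult_2 kappa_mult distrib_right coeff_add coeff_smult)
  ultimately show ?thesis
    using alpha_nz by (simp add: U2 numeral_2_eq_2)
qed

end

subsection \<open>Leading coefficients\<close>

text \<open>Here \<gamma> and \<open>a\<close> are the leading coefficients of \<open>D\<close> and
  \<open>S\<close> on powers of x. The recurrences reflect multiplication by x and treat both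
  branches at once.\<close>

locale half_step_lattice_coeffs = half_step_lattice +
  fixes \<gamma> a :: "nat \<Rightarrow> complex"
  assumes gamma_0: "\<gamma> 0 = 0" and a_0: "a 0 = 1"
    and gamma_Suc: "\<gamma> (Suc n) = a n + \<alpha> * \<gamma> n"
    and a_Suc: "a (Suc n) = (\<alpha>\<^sup>2 - 1) * \<gamma> n + \<alpha> * a n"
    and a_nz: "a n \<noteq> 0" and gamma_nz: "\<gamma> (Suc n) \<noteq> 0"
begin

text \<open>With w^2 = \<alpha>^2 - 1, each recurrence step multiplies \<open>a n\<close> + w
  \<gamma>(n) by \<alpha> + w, whose norm is 1.\<close>

lemma a_gamma_pell: "(a n)\<^sup>2 - (\<alpha>\<^sup>2 - 1) * (\<gamma> n)\<^sup>2 = 1"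
proof (induction n)
  case (Suc n)
  have "(a (Suc n))\<^sup>2 - (\<alpha>\<^sup>2 - 1) * (\<gamma> (Suc n))\<^sup>2 = (a n)\<^sup>2 - (\<alpha>\<^sup>2 - 1) * (\<gamma> n)\<^sup>2"
    by (simp add: gamma_Suc a_Suc power2_eq_square algebra_simps)
  with Suc show ?case by simp
qed (simp add: gamma_0 a_0)

text \<open>The polarised form of \<open>a_gamma_pell\<close> at consecutive indices; it evaluates
  the leading coefficient of \<open>S g + U2 * D k\<close> in \<open>lift_to_u\<close>.\<close>

lemma a_gamma_addition: "a n * a (Suc n) - (\<alpha>\<^sup>2 - 1) * (\<gamma> (Suc n) * \<gamma> n) = \<alpha>"
proof -
  have "a n * a (Suc n) - (\<alpha>\<^sup>2 - 1) * (\<gamma> (Suc n) * \<gamma> n)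
      = \<alpha> * ((a n)\<^sup>2 - (\<alpha>\<^sup>2 - 1) * (\<gamma> n)\<^sup>2)"
    by (simp add: gamma_Suc a_Suc power2_eq_square algebra_simps)
  then show ?thesis by (simp add: a_gamma_pell)
qed

text \<open>The factor \<open>x\<close> in front of \<open>D p\<close> avoids the truncated exponent \<open>n - 1\<close>.\<close>

lemma leading_S_D:
  assumes "degree p \<le> n"
  shows "degree (S p) \<le> n \<and> coeff (S p) n = a n * coeff p n
    \<and> degree (pCons 0 (D p)) \<le> n \<and> coeff (pCons 0 (D p)) n = \<gamma> n * coeff p n"
  using assms
proof (induction n arbitrary: p)
  case 0
  then obtain c where "p = [:c:]" using degree_eq_zeroE by blast
  then show ?case by (simp add: S_const D_const gamma_0 a_0)
next
  case (Suc n)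
  obtain c r where p: "p = pCons c r" by (cases p) auto
  have r: "degree r \<le> n"
    using Suc.prems by (auto simp: p split: if_splits)
  define l where "l = [:\<beta> / 2, \<alpha>:]"
  have l: "degree l \<le> 1" "coeff l 1 = \<alpha>" by (simp_all add: l_def)
  define E where "E = pCons 0 (D r)"
  have IH: "degree (S r) \<le> n" "coeff (S r) n = a n * coeff r n"
      "degree E \<le> n" "coeff E n = \<gamma> n * coeff r n"
    using Suc.IH[OF r] by (simp_all add: E_def)
  have xD: "pCons 0 (D p) = pCons 0 (S r) + l * E"
    by (simp add: p D_pCons l_def E_def)
  have lE: "degree (l * E) \<le> Suc n" "coeff (l * E) (Suc n) = \<alpha> * coeff E n"
    using degree_mult_le_degrees[OF l(1) IH(3)] coeff_mult_le_degrees[OF l(1) IH(3)] l(2) by simp_all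
  have D: "degree (pCons 0 (D p)) \<le> Suc n" "coeff (pCons 0 (D p)) (Suc n) = \<gamma> (Suc n) * coeff p (Suc n)"
    unfolding xD
    by (intro degree_add_le order.trans[OF degree_pCons_le])
      (use lE IH in \<open>simp_all add: p gamma_Suc algebra_simps\<close>)
  have lS: "degree (l * S r) \<le> Suc n" "coeff (l * S r) (Suc n) = \<alpha> * coeff (S r) n"
    using degree_mult_le_degrees[OF l(1) IH(1)] coeff_mult_le_degrees[OF l(1) IH(1)] l(2) by simp_all
  have xUD: "pCons 0 (U2 * D r) = U2 * E" by (simp add: E_def)
  have "degree (pCons 0 (U2 * D r)) \<le> 2 + n"
    unfolding xUD by (rule degree_mult_le_degrees[OF degree_U2 IH(3)])
  then have UD: "degree (U2 * D r) \<le> Suc n"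
    by (auto split: if_splits)
  have "coeff (pCons 0 (U2 * D r)) (2 + n) = (\<alpha>\<^sup>2 - 1) * coeff E n"
    unfolding xUD coeff_U2[symmetric] by (rule coeff_mult_le_degrees[OF degree_U2 IH(3)])
  then have cUD: "coeff (U2 * D r) (Suc n) = (\<alpha>\<^sup>2 - 1) * coeff E n"
    by simp
  have Sp: "S p = [:c:] + U2 * D r + l * S r"
    by (simp add: p S_pCons l_def)
  have "degree (S p) \<le> Suc n"
    unfolding Sp by (intro degree_add_le UD lS) simp
  moreover have "coeff (S p) (Suc n) = a (Suc n) * coeff p (Suc n)"
    unfolding Sp by (simp add: cUD lS IH p a_Suc algebra_simps)
  ultimately show ?case using D by simp
qed

lemma leading_S:
  assumes "degree p \<le> n"
  shows "degree (S p) \<le> n" and "coeff (S p) n = a n * coeff p n"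
  using leading_S_D[OF assms] by simp_all

lemma leading_D:
  assumes "degree p \<le> Suc n"
  shows "degree (D p) \<le> n" and "coeff (D p) n = \<gamma> (Suc n) * coeff p (Suc n)"
  using leading_S_D[OF assms] by (auto split: if_splits)

lemma degree_D_exact:
  assumes "degree p = Suc n"
  shows "degree (D p) = n"
proof (rule antisym)
  have "coeff (D p) n \<noteq> 0"
    using leading_D(2)[of p n] assms gamma_nz[of n] leading_coeff_neq_0[of p] by fastforce
  then show "n \<le> degree (D p)" by (rule le_degree)
qed (use leading_D(1) assms in simp)

lemma degree_D_eq_0:
  assumes "D p = 0"
  shows "degree p = 0"
proof (cases "degree p")
  case (Suc n)
  then show ?thesis
    using leading_D(2)[of p n] assms gamma_nz[of n] leading_coeff_neq_0[of p] by fastforce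
qed

text \<open>\<open>S\<close> is triangular on the powers of x, with nonzero diagonal entries
  \<open>a n\<close>.\<close>

lemma S_surj:
  assumes "degree p \<le> n"
  shows "\<exists>k. degree k \<le> n \<and> S k = p"
  using assms
proof (induction n arbitrary: p)
  case 0
  then obtain c where "p = [:c:]" using degree_eq_zeroE by blast
  then have "degree p \<le> 0 \<and> S p = p" by (simp add: S_const)
  then show ?case by blast
next
  case (Suc n)
  define m where "m = monom (coeff p (Suc n) / a (Suc n)) (Suc n)"
  have m: "degree m \<le> Suc n" by (simp add: m_def degree_monom_le)
  have "degree (p - S m) \<le> n"
  proof (rule degree_le_minus_leading)
    show "degree (p - S m) \<le> Suc n" by (intro degree_diff_le Suc.prems leading_S m)
    show "coeff (p - S m) (Suc n) = 0"
      using a_nz by (simp add: leading_S(2)[OF m]) (simp add: m_def)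
  qed
  from Suc.IH[OF this] obtain k where k: "degree k \<le> n" "S k = p - S m" by blast
  then have "degree (m + k) \<le> Suc n \<and> S (m + k) = p"
    using m by (auto simp: S_add intro: degree_add_le)
  then show ?case by blast
qed

text \<open>If the norm vanished, cancelling \<open>p\<close> in its images under \<open>S\<close>
  and \<open>D\<close> would give \<open>2 * S (S p) = p\<close> and \<open>D (S p) = 0\<close>.
  Then \<open>S p\<close> is constant, so \<open>p = 2 * S p\<close>; applying \<open>S\<close>
  again yields \<open>p = 2 * p\<close>.\<close>

lemma lattice_norm_nz:
  assumes "p \<noteq> 0"
  shows "lattice_norm p \<noteq> 0"
proof
  assume "lattice_norm p = 0"
  with S_lattice_norm[of p] D_lattice_norm[of p] assms
  have SSp: "2 * S (S p) = p" and "D (S p) = 0" by auto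
  then have "degree (S p) = 0"
    using degree_D_eq_0 by blast
  then obtain c where "S p = [:c:]" by (rule degree_eq_zeroE)
  then have "S (S p) = S p" by (simp add: S_const)
  with SSp have "p = 2 * S p" by simp
  then have "S p = 2 * S (S p)"
    by (metis S_smult mult_2 smult_add_left smult_1_left one_add_one)
  with SSp \<open>p = 2 * S p\<close> have "p = 2 * p" by simp
  with assms show False by (metis add_cancel_right_right mult_2)
qed

end

subsection \<open>The derived functional\<close>

locale half_step_pearson = half_step_lattice_coeffs +
  fixes u :: "complex poly \<Rightarrow> complex" and \<phi> \<psi> :: "complex poly"
  assumes u: "u \<in> poly_dual"
    and deg_phi: "degree \<phi> \<le> 2" and deg_psi: "degree \<psi> \<le> 1"
    and nontrivial: "\<not> (\<phi> = 0 \<and> \<psi> = 0)"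
    and pearson: "u (\<phi> * D f + \<psi> * S f) = 0"
begin

lemmas u_simps = poly_dual_simps[OF u]

definition v :: "complex poly \<Rightarrow> complex" where
  "v p = - u (U2 * \<psi> * D p + \<phi> * S p)"

definition \<chi> :: "complex poly" where "\<chi> = \<kappa> * \<phi> + U1 * \<psi>"

definition d :: "nat \<Rightarrow> complex" where "d n = coeff \<phi> 2 * \<gamma> n + coeff \<psi> 1 * a n"

lemma v_dual: "v \<in> poly_dual"
  unfolding poly_dual_iff
  by (auto simp: v_def D_add S_add D_smult S_smult distrib_left u_simps algebra_simps)

lemmas v_simps = poly_dual_simps[OF v_dual]

lemma v_D: "v (D p) = \<alpha> * u (\<psi> * p)"
proof -
  \<comment> \<open>Chosen so that \<open>D f = S (D p)\<close> and \<open>S f\<close> is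
    \<open>U2 * D (D p)\<close> up to \<alpha> \<open>p\<close>: the test expression is then the
    argument of \<open>u\<close> in \<open>v (D p)\<close> plus a multiple of
    \<open>\<psi> * p\<close>.\<close>
  define f where "f = \<kappa> * S p - U1 * D p"
  have "D f = S (D p)"
    unfolding f_def D_diff D_mult kappa_const D_U1 S_U1 D_S
    by (simp add: power2_eq_square algebra_simps)
  moreover have "S f = U2 * D (D p) + \<kappa> * p"
    unfolding f_def S_diff S_mult kappa_const D_U1 S_U1 S_S by algebra
  ultimately have "\<phi> * D f + \<psi> * S f = (U2 * \<psi> * D (D p) + \<phi> * S (D p)) + smult \<alpha> (\<psi> * p)"
    unfolding kappa_mult[symmetric] by (simp add: algebra_simps)
  with pearson[of f] show ?thesis
    by (simp add: v_def u_simps(1,2) add_eq_0_iff)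
qed

lemma v_S: "v (S p) = - \<alpha> * u (\<chi> * p)"
proof -
  \<comment> \<open>Now \<open>D f\<close> and \<open>S f\<close> are \<open>S (S p)\<close> and
    \<open>U2 * D (S p)\<close> up to multiples of \<open>p\<close>; these multiples combine to
    \<alpha> \<chi> \<open>p\<close>.\<close>
  define f where "f = \<kappa> * (U2 * D p) - U1 * S p"
  have Df: "D f = S (S p) - \<kappa>\<^sup>2 * p"
    unfolding f_def D_diff D_mult kappa_const D_U1 S_U1 D_U2 S_U2 D_S S_S by algebra
  have Sf: "S f = U2 * D (S p) - \<kappa> * U1 * p"
    unfolding f_def S_diff S_mult kappa_const D_U1 S_U1 D_U2 S_U2 D_S S_S by algebra
  have "\<phi> * D f + \<psi> * S f
      = (U2 * \<psi> * D (S p) + \<phi> * S (S p)) - smult \<alpha> (\<chi> * p)"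
    unfolding \<chi>_def Df Sf kappa_mult[symmetric] by (simp add: power2_eq_square algebra_simps)
  with pearson[of f] show ?thesis
    by (simp add: v_def u_simps)
qed

lemma v_D_mult: "v (S g * D p) = \<alpha> * u (\<psi> * g * p) - v (D g * S p)"
  using v_D[of "g * p"] by (simp add: D_mult v_simps mult.assoc algebra_simps)

lemma v_S_mult: "v (U2 * D g * D p) = - \<alpha> * u (\<chi> * g * p) - v (S g * S p)"
  using v_S[of "g * p"] by (simp add: S_mult v_simps mult.assoc algebra_simps)

text \<open>The equation \<open>S k = - D g\<close> makes the terms in \<open>S p\<close> cancel.\<close>

lemma v_cancel:
  assumes "S k = - D g"
  shows "v ((S g + U2 * D k) * D p) = \<alpha> * u ((\<psi> * g - \<chi> * k) * p)"
  using v_D_mult[of g p] v_S_mult[of k p]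
  by (simp add: assms distrib_right left_diff_distrib v_simps(1,4,5) u_simps(5) right_diff_distrib)

text \<open>Taking \<open>g\<close> = \<chi> in \<open>v_D_mult\<close> and \<open>g\<close> =
  \<psi> in \<open>v_S_mult\<close> produces the same term in \<open>u\<close> with opposite signs.
  This is the functional equation that makes \<open>v\<close> classical.\<close>

lemma pearson_v:
  "v ((S \<chi> + U2 * D \<psi>) * D p + (D \<chi> + S \<psi>) * S p) = 0"
  using v_D_mult[of \<chi> p] v_S_mult[of \<psi> p]
  by (simp add: distrib_right v_simps(1) mult.commute[of \<chi> \<psi>])

section \<open>Transfer to \<open>u\<close> and orthogonality of the derived family\<close>

lemma degree_U1: "degree U1 \<le> 1" and coeff_U1: "coeff U1 1 = \<alpha>\<^sup>2 - 1"
  by (simp_all add: U1_def)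

lemma degree_chi: "degree \<chi> \<le> 2"
  and coeff_chi: "coeff \<chi> 2 = \<alpha> * coeff \<phi> 2 + (\<alpha>\<^sup>2 - 1) * coeff \<psi> 1"
proof -
  have "degree (U1 * \<psi>) \<le> 2" "coeff (U1 * \<psi>) 2 = (\<alpha>\<^sup>2 - 1) * coeff \<psi> 1"
    using degree_mult_le_degrees[OF degree_U1 deg_psi] coeff_mult_le_degrees[OF degree_U1 deg_psi]
    unfolding coeff_U1 one_add_one by simp_all
  then show "degree \<chi> \<le> 2" "coeff \<chi> 2 = \<alpha> * coeff \<phi> 2 + (\<alpha>\<^sup>2 - 1) * coeff \<psi> 1"
    using deg_phi unfolding \<chi>_def kappa_mult
    by (auto intro!: degree_add_le order.trans[OF degree_smult_le])
qed

text \<open>Pairings with \<open>v\<close> become pairings with \<open>u\<close> at one degree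
  higher, where the orthogonality of \<open>P\<close> applies. The top term of \<open>f\<close> is
  handled by \<open>v_cancel\<close>, the rest by induction.\<close>

lemma lift_to_u:
  assumes "degree f \<le> n"
  shows "\<exists>w. degree w \<le> Suc n \<and> coeff w (Suc n) = \<alpha> * d n * coeff f n \<and> (\<forall>p. v (f * D p) = u (w * p))"
  using assms
proof (induction n arbitrary: f)
  case 0
  then obtain c where f: "f = [:c:]" using degree_eq_zeroE by blast
  have "v (f * D p) = u (smult (\<alpha> * c) \<psi> * p)" for p
    by (simp add: f v_simps u_simps v_D)
  moreover have "degree (smult (\<alpha> * c) \<psi>) \<le> Suc 0"
    using deg_psi by (intro order.trans[OF degree_smult_le]) simp
  moreover have "coeff (smult (\<alpha> * c) \<psi>) (Suc 0) = \<alpha> * d 0 * coeff f 0"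
    by (simp add: f d_def gamma_0 a_0)
  ultimately show ?case by blast
next
  case (Suc n)
  \<comment> \<open>By \<open>a_gamma_addition\<close>, \<open>S g + U2 * D k\<close> has leading
    coefficient \<open>c * \<alpha> / a n\<close>; this \<open>c\<close> makes it agree with that of
    \<open>f\<close>.\<close>
  define c where "c = coeff f (Suc n) * a n / \<alpha>"
  define g where "g = monom c (Suc n)"
  have g: "degree g \<le> Suc n" "coeff g (Suc n) = c" by (simp_all add: g_def degree_monom_le)
  have "degree (- D g) \<le> n" using leading_D(1)[OF g(1)] by simp
  from S_surj[OF this] obtain k where k: "degree k \<le> n" "S k = - D g" by blast
  have ck: "a n * coeff k n = - \<gamma> (Suc n) * c"
    using leading_S(2)[OF k(1)] leading_D(2)[OF g(1)] by (simp add: k(2) g(2))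
  then have ck': "coeff k n = - \<gamma> (Suc n) * c / a n"
    using a_nz[of n] by (simp add: field_simps)
  define f0 where "f0 = S g + U2 * D k"
  define w0 where "w0 = smult \<alpha> (\<psi> * g - \<chi> * k)"
  have f0_lift: "v (f0 * D p) = u (w0 * p)" for p
    unfolding f0_def w0_def v_cancel[OF k(2)] by (simp add: u_simps(2))
  have xD: "degree (pCons 0 (D k)) \<le> n" "coeff (pCons 0 (D k)) n = \<gamma> n * coeff k n"
    using leading_S_D[OF k(1)] by simp_all
  \<comment> \<open>\<open>leading_S_D\<close> controls x \<open>D k\<close>, so the product is
    estimated after multiplication by x and then shifted back.\<close>
  have xUD: "pCons 0 (U2 * D k) = U2 * pCons 0 (D k)" by simp
  have "degree (pCons 0 (U2 * D k)) \<le> 2 + n" "coeff (pCons 0 (U2 * D k)) (2 + n) = (\<alpha>\<^sup>2 - 1) * (\<gamma> n * coeff k n)"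
    unfolding xUD using degree_mult_le_degrees[OF degree_U2 xD(1)]
      coeff_mult_le_degrees[OF degree_U2 xD(1)] xD(2) coeff_U2 by simp_all
  then have UD: "degree (U2 * D k) \<le> Suc n" "coeff (U2 * D k) (Suc n) = (\<alpha>\<^sup>2 - 1) * (\<gamma> n * coeff k n)"
    by (auto split: if_splits)
  have deg_f0: "degree f0 \<le> Suc n"
    unfolding f0_def by (intro degree_add_le leading_S g UD)
  have "coeff f0 (Suc n) = a (Suc n) * c + (\<alpha>\<^sup>2 - 1) * (\<gamma> n * coeff k n)"
    by (simp add: f0_def leading_S(2)[OF g(1)] g(2) UD(2))
  also have "\<dots> = c * (a n * a (Suc n) - (\<alpha>\<^sup>2 - 1) * (\<gamma> (Suc n) * \<gamma> n)) / a n"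
    using a_nz[of n] by (simp add: ck' field_simps)
  also have "\<dots> = coeff f (Suc n)"
    using a_nz[of n] alpha_nz by (simp add: a_gamma_addition c_def)
  finally have cf0: "coeff f0 (Suc n) = coeff f (Suc n)" .
  have "degree (\<psi> * g) \<le> 1 + Suc n" "degree (\<chi> * k) \<le> 2 + n"
    by (rule degree_mult_le_degrees[OF deg_psi g(1)] degree_mult_le_degrees[OF degree_chi k(1)])+
  then have deg_w0: "degree w0 \<le> Suc (Suc n)"
    unfolding w0_def by (intro order.trans[OF degree_smult_le] degree_diff_le) simp_all
  have "coeff w0 (Suc (Suc n)) = \<alpha> * (coeff \<psi> 1 * c - coeff \<chi> 2 * coeff k n)"
    using coeff_mult_le_degrees[OF deg_psi g(1)] coeff_mult_le_degrees[OF degree_chi k(1)]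
    by (simp add: w0_def g(2))
  also have "\<dots> = \<alpha> * c / a n *
      (coeff \<psi> 1 * (a n + (\<alpha>\<^sup>2 - 1) * \<gamma> (Suc n)) + \<alpha> * coeff \<phi> 2 * \<gamma> (Suc n))"
    using a_nz[of n] by (simp add: ck' coeff_chi field_simps)
  also have "a n + (\<alpha>\<^sup>2 - 1) * \<gamma> (Suc n) = \<alpha> * a (Suc n)"
    by (simp add: gamma_Suc a_Suc power2_eq_square algebra_simps)
  also have "\<alpha> * c / a n * (coeff \<psi> 1 * (\<alpha> * a (Suc n)) + \<alpha> * coeff \<phi> 2 * \<gamma> (Suc n))
      = \<alpha> * d (Suc n) * coeff f (Suc n)"
    using a_nz[of n] alpha_nz by (simp add: c_def d_def field_simps)
  finally have cw0: "coeff w0 (Suc (Suc n)) = \<alpha> * d (Suc n) * coeff f (Suc n)" .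
  \<comment> \<open>The lift of the remainder has degree at most \<open>Suc n\<close> and leaves the
    coefficient at \<open>Suc (Suc n)\<close> untouched.\<close>
  have "degree (f - f0) \<le> n"
    by (rule degree_le_minus_leading[OF degree_diff_le[OF Suc.prems deg_f0]]) (simp add: cf0)
  from Suc.IH[OF this] obtain w where w: "degree w \<le> Suc n" "\<And>p. v ((f - f0) * D p) = u (w * p)"
    by blast
  have "v (f * D p) = u ((w + w0) * p)" for p
    using w(2)[of p] f0_lift[of p] by (simp add: left_diff_distrib distrib_right v_simps(5) u_simps(1) diff_eq_eq)
  moreover have "degree (w + w0) \<le> Suc (Suc n)"
    using w(1) deg_w0 by (intro degree_add_le) simp_all
  moreover have "coeff (w + w0) (Suc (Suc n)) = \<alpha> * d (Suc n) * coeff f (Suc n)"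
    using w(1) by (simp add: cw0 coeff_eq_0)
  ultimately show ?case by blast
qed

text \<open>Against \<open>P (Suc n)\<close> only the top coefficient of the lift of
  \<open>f\<close> survives. The formula gives both orthogonality and norms.\<close>

lemma v_D_orthogonal:
  assumes P: "monic_orthogonal_family I u P" and I: "{..Suc n} \<subseteq> I" and f: "degree f \<le> n"
  shows "v (f * D (P (Suc n))) = \<alpha> * d n * coeff f n * u ((P (Suc n))\<^sup>2)"
proof -
  obtain w where w: "degree w \<le> Suc n" "coeff w (Suc n) = \<alpha> * d n * coeff f n"
    "\<And>p. v (f * D p) = u (w * p)"
    using lift_to_u[OF f] by blast
  have "u (P (Suc n) * w) = coeff w (Suc n) * u ((P (Suc n))\<^sup>2)"
    by (rule monic_orthogonal_family_same_degree[OF u P I w(1)])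
  then show ?thesis
    by (simp add: w mult.commute)
qed

text \<open>If \<open>p v = 0\<close>, then \<open>S\<close> and \<open>D\<close> of the lattice norm of \<open>p\<close> are multiples of \<open>p\<close>, so the
  identities \<open>v_D_mult\<close> and \<open>v_S_mult\<close> say that \<open>\<psi>\<close> and \<open>\<chi>\<close> times the lattice norm annihilate \<open>u\<close>.\<close>

lemma v_annihilator_zero:
  assumes P: "monic_orthogonal_family UNIV u P" and p: "\<And>f. v (p * f) = 0"
  shows "p = 0"
proof (rule ccontr)
  assume "p \<noteq> 0"
  define G where "G = lattice_norm p"
  have G: "G \<noteq> 0" unfolding G_def by (rule lattice_norm_nz) fact
  have SG: "v (S G * f) = 0" for f
    using p[of "(2 * S (S p) - p) * f"] by (simp add: G_def S_lattice_norm mult.assoc)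
  have DG: "v (D G * f) = 0" for f
    using p[of "(2 * D (S p)) * f"] by (simp add: G_def D_lattice_norm mult.assoc)
  have UDG: "v (U2 * D G * f) = 0" for f
    using DG[of "U2 * f"] by (simp add: mult_ac)
  have "u (\<psi> * G * f) = 0" "u (\<chi> * G * f) = 0" for f
    using v_D_mult[of G f] v_S_mult[of G f] alpha_nz by (simp_all add: SG DG UDG)
  then have "\<psi> * G = 0" "\<chi> * G = 0"
    using orthogonal_family_regular_mult_zero[OF u P] by blast+
  with G have "\<psi> = 0" and "\<chi> = 0" by auto
  from \<open>\<chi> = 0\<close> have "\<kappa> * \<phi> + U1 * \<psi> = 0" unfolding \<chi>_def .
  then have "\<phi> = 0" using alpha_nz \<open>\<psi> = 0\<close> by (simp add: kappa_mult)
  with \<open>\<psi> = 0\<close> nontrivial show False by simp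
qed

text \<open>If \<open>d n = 0\<close>, then \<open>D (P (Suc n))\<close> pairs to zero under
  \<open>v\<close> with every \<open>D (P (Suc m))\<close>: for \<open>m > n\<close> by degree, for
  \<open>m \<le> n\<close> through the factor \<open>d n\<close>. These polynomials form a basis, so
  \<open>v_annihilator_zero\<close> gives a contradiction.\<close>

lemma d_nz_of_regular:
  assumes P: "monic_orthogonal_family UNIV u P"
  shows "d n \<noteq> 0"
proof
  assume "d n = 0"
  have degP: "degree (P m) = m" for m
    using P by (simp add: monic_orthogonal_family_def orthogonal_family_def)
  have degD: "degree (D (P (Suc m))) = m" for m
    by (rule degree_D_exact) (rule degP)
  have nz: "D (P (Suc m)) \<noteq> 0" for m
    using leading_D(2)[of "P (Suc m)" m] degP[of "Suc m"] gamma_nz[of m] P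
    by (auto simp: monic_orthogonal_family_def dest!: spec[of _ "Suc m"])
  have zero: "v (D (P (Suc n)) * D (P (Suc m))) = 0" for m
  proof (cases m n rule: linorder_cases)
    case greater
    then have "v (D (P (Suc n)) * D (P (Suc m))) = \<alpha> * d m * coeff (D (P (Suc n))) m * u ((P (Suc m))\<^sup>2)"
      by (intro v_D_orthogonal[OF P]) (simp_all add: degD)
    then show ?thesis using greater by (simp add: coeff_eq_0 degD)
  next
    case equal
    then show ?thesis
      using v_D_orthogonal[OF P, of n "D (P (Suc n))"] by (simp add: degD \<open>d n = 0\<close>)
  next
    case less
    then have "v (D (P (Suc m)) * D (P (Suc n))) = \<alpha> * d n * coeff (D (P (Suc m))) n * u ((P (Suc n))\<^sup>2)"
      by (intro v_D_orthogonal[OF P]) (simp_all add: degD)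
    then show ?thesis by (simp add: mult.commute \<open>d n = 0\<close>)
  qed
  have "v (D (P (Suc n)) * f) = 0" for f
    by (rule poly_basis_induct[of f "Suc (degree f)" "\<lambda>m. D (P (Suc m))"
          "\<lambda>f. v (D (P (Suc n)) * f) = 0"])
      (simp_all add: degD nz zero distrib_left v_simps(1,2,3))
  from v_annihilator_zero[OF P this] nz show False by simp
qed

text \<open>The norm of \<open>Q n\<close> is \<alpha> \<open>d n\<close> times that of
  \<open>P (Suc n)\<close>, divided by \<open>\<gamma> (Suc n)\<close>. The set \<open>J\<close>
  serves the finite and the infinite case alike.\<close>

lemma derivative_family_orthogonal:
  assumes P: "monic_orthogonal_family I u P"
    and I: "\<And>n. n \<in> J \<Longrightarrow> {..Suc n} \<subseteq> I"
    and d: "\<And>n. n \<in> J \<Longrightarrow> d n \<noteq> 0"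
    and Q: "\<And>n. n \<in> J \<Longrightarrow> Q n = smult (inverse (\<gamma> (Suc n))) (D (P (Suc n)))"
  shows "monic_orthogonal_family J v Q"
proof -
  have P_facts: "degree (P (Suc n)) = Suc n" "coeff (P (Suc n)) (Suc n) = 1" "u ((P (Suc n))\<^sup>2) \<noteq> 0"
    if "n \<in> J" for n
  proof -
    have "Suc n \<in> I" using I[OF that] by auto
    then show "degree (P (Suc n)) = Suc n" "coeff (P (Suc n)) (Suc n) = 1" "u ((P (Suc n))\<^sup>2) \<noteq> 0"
      using P unfolding monic_orthogonal_family_def orthogonal_family_def by metis+
  qed
  have deg: "degree (Q n) = n" and lead: "coeff (Q n) n = 1" if "n \<in> J" for n
    using degree_D_exact[OF P_facts(1)[OF that]] leading_D(2)[of "P (Suc n)" n] gamma_nz[of n]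
      P_facts(1,2)[OF that] by (simp_all add: Q[OF that])
  have prod: "v (Q n * f) = inverse (\<gamma> (Suc n)) * (\<alpha> * d n * coeff f n * u ((P (Suc n))\<^sup>2))"
    if "n \<in> J" "degree f \<le> n" for n f
    using v_D_orthogonal[OF P I[OF that(1)] that(2)]
    by (simp add: Q[OF that(1)] v_simps(2) mult.commute[of f])
  have "v (Q n * Q m) = 0" if "n \<in> J" "m \<in> J" "m < n" for n m
    using prod[of n "Q m"] that deg[of m] by (simp add: coeff_eq_0)
  moreover have "v ((Q n)\<^sup>2) \<noteq> 0" if "n \<in> J" for n
    using prod[of n "Q n"] that deg[of n] lead[of n] d[of n] P_facts(3)[of n] gamma_nz[of n] alpha_nz
    by (simp add: power2_eq_square)
  ultimately show ?thesis
    using deg lead by (simp add: monic_orthogonal_family_def orthogonal_family_def)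
qed

text \<open>The witnesses come from \<open>pearson_v\<close>; they are not both zero because the
  coefficient of x in \<open>D \<chi> + S \<psi>\<close> is \<alpha> \<open>d 2\<close>.\<close>

lemma pearson_v_exists:
  assumes "d 2 \<noteq> 0"
  shows "\<exists>\<phi>' \<psi>'. degree \<phi>' \<le> 2 \<and> degree \<psi>' \<le> 1 \<and> \<not> (\<phi>' = 0 \<and> \<psi>' = 0)
    \<and> (\<forall>p. v (\<phi>' * D p + \<psi>' * S p) = 0)"
proof (intro exI conjI)
  have chi: "degree \<chi> \<le> Suc 1" and psi: "degree \<psi> \<le> Suc 0" using degree_chi deg_psi by simp_all
  have "degree (U2 * D \<psi>) \<le> 2 + 0"
    by (rule degree_mult_le_degrees[OF degree_U2 leading_D(1)[OF psi]])
  then show "degree (S \<chi> + U2 * D \<psi>) \<le> 2"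
    by (intro degree_add_le leading_S degree_chi) simp
  show "degree (D \<chi> + S \<psi>) \<le> 1"
    by (intro degree_add_le leading_D(1)[OF chi] leading_S deg_psi)
  have vals: "\<gamma> 1 = 1" "a 1 = \<alpha>" "\<gamma> 2 = 2 * \<alpha>" "a 2 = 2 * \<alpha>\<^sup>2 - 1"
    by (simp_all add: numeral_2_eq_2 gamma_Suc a_Suc gamma_0 a_0 power2_eq_square)
  have "coeff (D \<chi> + S \<psi>) 1 = \<gamma> 2 * coeff \<chi> 2 + a 1 * coeff \<psi> 1"
    using leading_D(2)[OF chi] leading_S(2)[OF deg_psi] by (simp add: numeral_2_eq_2)
  also have "\<dots> = \<alpha> * d 2"
    unfolding vals coeff_chi d_def by (simp add: power2_eq_square algebra_simps)
  finally have "coeff (D \<chi> + S \<psi>) 1 \<noteq> 0" using assms alpha_nz by simp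
  then have "D \<chi> + S \<psi> \<noteq> 0" by (metis coeff_0)
  then show "\<not> (S \<chi> + U2 * D \<psi> = 0 \<and> D \<chi> + S \<psi> = 0)" by simp
  show "\<forall>p. v ((S \<chi> + U2 * D \<psi>) * D p + (D \<chi> + S \<psi>) * S p) = 0"
    using pearson_v by simp
qed

end

subsection \<open>The two branches\<close>

text \<open>With \<eta> = r + 1/r the recurrences are hyperbolic addition formulas. A zero of
  \<open>a n\<close> or of \<gamma>(n + 1) would make a positive power of q equal to 1.\<close>

lemma gamma_alpha_coeffs:
  assumes "\<eta> = 2 \<or> (q_exponential_branch \<eta> q r \<and> \<not> root_of_unity q)"
  defines "a \<equiv> \<lambda>n. if \<eta> = 2 then 1 else alpha_coeff r n"
  shows "gamma_coeff \<eta> r 0 = 0" "a 0 = 1"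
    and "gamma_coeff \<eta> r (Suc n) = a n + \<eta> / 2 * gamma_coeff \<eta> r n"
    and "a (Suc n) = ((\<eta> / 2)\<^sup>2 - 1) * gamma_coeff \<eta> r n + \<eta> / 2 * a n"
    and "a n \<noteq> 0" and "gamma_coeff \<eta> r (Suc n) \<noteq> 0"
proof -
  show "gamma_coeff \<eta> r 0 = 0" "a 0 = 1"
    by (simp_all add: gamma_coeff_def a_def alpha_coeff_def)
  have "gamma_coeff \<eta> r (Suc n) = a n + \<eta> / 2 * gamma_coeff \<eta> r n
    \<and> a (Suc n) = ((\<eta> / 2)\<^sup>2 - 1) * gamma_coeff \<eta> r n + \<eta> / 2 * a n
    \<and> a n \<noteq> 0 \<and> gamma_coeff \<eta> r (Suc n) \<noteq> 0"
  proof (cases "\<eta> = 2")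
    case True
    then show ?thesis by (simp add: gamma_coeff_def a_def flip: of_nat_Suc)
  next
    case False
    then have br: "q_exponential_branch \<eta> q r" "\<not> root_of_unity q"
      using assms by auto
    have "r \<noteq> 0" using br by (auto simp: q_exponential_branch_def)
    have eta: "\<eta> = r + inverse r" and q: "q = r\<^sup>2" using br by (auto simp: q_exponential_branch_def)
    have no_root: "(r ^ m)\<^sup>2 \<noteq> 1" if "m \<ge> 1" for m
      using br(2) that by (auto simp: root_of_unity_def q simp flip: power_mult simp: mult.commute)
    define i where "i = inverse r"
    have ri: "r * i = 1" using \<open>r \<noteq> 0\<close> by (simp add: i_def)
    have ri': "i * (r * z) = z" for z using ri by (metis mult.assoc mult.commute mult_1)
    have "r - i \<noteq> 0"
      using no_root[of 1] ri by (auto simp: power2_eq_square)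
    define x y where "x = r ^ n" and "y = i ^ n"
    have xy: "x * y = 1" using ri by (simp add: x_def y_def flip: power_mult_distrib)
    have g: "gamma_coeff \<eta> r n = (x - y) / (r - i)" "gamma_coeff \<eta> r (Suc n) = (r * x - i * y) / (r - i)"
      using False by (simp_all add: gamma_coeff_def x_def y_def i_def power_inverse)
    have al: "a n = (x + y) / 2" "a (Suc n) = (r * x + i * y) / 2"
      using False by (simp_all add: a_def alpha_coeff_def x_def y_def i_def power_inverse)
    have 1: "gamma_coeff \<eta> r (Suc n) = a n + \<eta> / 2 * gamma_coeff \<eta> r n"
      using \<open>r - i \<noteq> 0\<close> unfolding g al unfolding eta i_def[symmetric] by (simp add: field_simps)
    have "(\<eta> / 2)\<^sup>2 - 1 = (r - i)\<^sup>2 / 4"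
      using ri unfolding eta i_def[symmetric] by (simp add: field_simps power2_eq_square)
    then have 2: "a (Suc n) = ((\<eta> / 2)\<^sup>2 - 1) * gamma_coeff \<eta> r n + \<eta> / 2 * a n"
      using \<open>r - i \<noteq> 0\<close> unfolding g al by (simp add: eta i_def[symmetric] power2_eq_square) (simp add: field_simps ri')
    have 3: "a n \<noteq> 0"
    proof
      assume "a n = 0"
      then have "y = - x" by (simp add: al add_eq_0_iff)
      with xy have "x\<^sup>2 = -1" by (simp add: power2_eq_square minus_equation_iff)
      then have "(x\<^sup>2)\<^sup>2 = 1" by simp
      moreover have "(x\<^sup>2)\<^sup>2 = (r ^ (2 * n))\<^sup>2" by (simp add: x_def power_mult mult.commute flip: power_mult)
      \<comment> \<open>The root-of-unity condition speaks of positive exponents only; for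
        \<open>n = 0\<close> both \<open>x\<close> and \<open>y\<close> are 1, which excludes
        \<open>y = - x\<close>.\<close>
      ultimately have "n = 0" using no_root[of "2 * n"] by (cases n) auto
      with \<open>y = - x\<close> show False by (simp add: x_def y_def)
    qed
    have 4: "gamma_coeff \<eta> r (Suc n) \<noteq> 0"
    proof
      assume "gamma_coeff \<eta> r (Suc n) = 0"
      then have "r * x = i * y" using \<open>r - i \<noteq> 0\<close> by (simp add: g)
      then have "(r * x)\<^sup>2 = (r * i) * (x * y)" by (simp add: power2_eq_square mult_ac)
      also have "\<dots> = 1" by (simp add: ri xy)
      finally have "(r ^ Suc n)\<^sup>2 = 1" by (simp add: x_def)
      then show False using no_root[of "Suc n"] by simp
    qed
    from 1 2 3 4 show ?thesis by simp
  qed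
  then show "gamma_coeff \<eta> r (Suc n) = a n + \<eta> / 2 * gamma_coeff \<eta> r n"
    "a (Suc n) = ((\<eta> / 2)\<^sup>2 - 1) * gamma_coeff \<eta> r n + \<eta> / 2 * a n"
    "a n \<noteq> 0" "gamma_coeff \<eta> r (Suc n) \<noteq> 0" by blast+
qed

theorem proposition9p6:
  fixes h \<eta> \<beta> q r :: complex
    and U :: "complex set"
    and X :: "complex \<Rightarrow> complex"
    and I I\<^sub>1 :: "nat set"
    and u u\<^sub>1 :: "complex poly \<Rightarrow> complex"
    and P Q :: "nat \<Rightarrow> complex poly"
    and \<phi> \<psi> U\<^sub>2 :: "complex poly"
  assumes "h \<noteq> 0"
    and "half_step_invariant h U"
    and "admissible h U X"
    and "branch_constants h U X \<eta> \<beta>"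
    and "\<eta> = 2 \<or> (q_exponential_branch \<eta> q r \<and> \<not> root_of_unity q)"
    and "u \<in> poly_dual"
    and "degree \<phi> \<le> 2" and "degree \<psi> \<le> 1" and "\<not> (\<phi> = 0 \<and> \<psi> = 0)"
    and "D_functional h U X (mult_functional \<phi> u) = S_functional h U X (mult_functional \<psi> u)"
    and "(I = UNIV \<and> I\<^sub>1 = UNIV) \<or>
         (\<exists>N\<ge>2. I = {0..N+1} \<and> I\<^sub>1 = {0..N} \<and> (\<forall>j\<in>{0..2*N+1}. d_coeff \<eta> r \<phi> \<psi> j \<noteq> 0))"
    and "monic_orthogonal_family I u P"
    and "U\<^sub>2 = Sop h U X ([:0, 1:]\<^sup>2) - (Sop h U X [:0, 1:])\<^sup>2"
    and "u\<^sub>1 = (\<lambda>p. D_functional h U X (mult_functional (U\<^sub>2 * \<psi>) u) p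
                  - S_functional h U X (mult_functional \<phi> u) p)"
    and "\<forall>n\<in>I\<^sub>1. Q n = smult (inverse (gamma_coeff \<eta> r (n + 1))) (Dop h U X (P (n + 1)))"
  shows "u\<^sub>1 \<in> poly_dual \<and> classical h U X u\<^sub>1 \<and> monic_orthogonal_family I\<^sub>1 u\<^sub>1 Q"
proof -
  define a where "a n = (if \<eta> = 2 then 1 else alpha_coeff r n)" for n
  note coeffs = gamma_alpha_coeffs[OF assms(5), folded a_def]
  have L: "half_step_lattice h \<eta> \<beta> U X"
    using assms(2,3,4,5) by unfold_locales (auto simp: q_exponential_branch_def)
  then interpret half_step_lattice h \<eta> \<beta> U X .
  have pearson: "u (\<phi> * D f + \<psi> * S f) = 0" for f
  proof -
    have "u (\<psi> * S f) = - u (\<phi> * D f)"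
      using fun_cong[OF assms(10), of f]
      by (simp add: D_functional_def S_functional_def mult_functional_def)
    then show ?thesis by (simp add: poly_dual_simps(1)[OF assms(6)])
  qed
  interpret half_step_pearson h \<eta> \<beta> U X "gamma_coeff \<eta> r" a u \<phi> \<psi>
    using coeffs assms(6-9) pearson by unfold_locales (simp_all add: \<alpha>_def)
  have u1: "u\<^sub>1 = v"
    unfolding assms(14) v_def U2_def assms(13)[symmetric]
    by (auto simp: D_functional_def S_functional_def mult_functional_def u_simps mult.assoc)
  have d: "d n = d_coeff \<eta> r \<phi> \<psi> n" for n
    by (simp add: d_def d_coeff_def a_def gamma_coeff_def)
  \<comment> \<open>Nonvanishing of \<open>d n\<close> comes from regularity in the infinite case
    and from the assumption on \<open>d_coeff\<close> in the finite one.\<close>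
  have I: "{..Suc n} \<subseteq> I" and d_nz: "d n \<noteq> 0" if "n \<in> I\<^sub>1" for n
    using assms(11,12) that d_nz_of_regular[of P n] by (auto simp: d)
  \<comment> \<open>In the finite case this is \<open>N \<ge> 2\<close>; it yields
    \<open>d 2 \<noteq> 0\<close> for \<open>pearson_v_exists\<close>.\<close>
  have "2 \<in> I\<^sub>1" using assms(11) by auto
  then obtain \<phi>' \<psi>' where pv: "degree \<phi>' \<le> 2" "degree \<psi>' \<le> 1" "\<not> (\<phi>' = 0 \<and> \<psi>' = 0)"
    "\<And>p. v (\<phi>' * D p + \<psi>' * S p) = 0"
    using pearson_v_exists[OF d_nz] by blast
  have "D_functional h U X (mult_functional \<phi>' v) = S_functional h U X (mult_functional \<psi>' v)"
    using pv(4) by (auto simp: D_functional_def S_functional_def mult_functional_def v_simps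
        fun_eq_iff add_eq_0_iff)
  moreover have Q: "monic_orthogonal_family I\<^sub>1 v Q"
    using assms(15) by (intro derivative_family_orthogonal[OF assms(12) I d_nz]) simp_all
  then have orth: "orthogonal_family I\<^sub>1 v Q"
    by (simp add: monic_orthogonal_family_def)
  have "regular v \<or> (\<exists>M. M + 1 \<ge> 3 \<and> regular_upto M v)"
    using assms(11)
  proof
    assume "I = UNIV \<and> I\<^sub>1 = UNIV"
    with orth show ?thesis by (auto simp: regular_def)
  next
    assume "\<exists>N\<ge>2. I = {0..N+1} \<and> I\<^sub>1 = {0..N} \<and> (\<forall>j\<in>{0..2*N+1}. d_coeff \<eta> r \<phi> \<psi> j \<noteq> 0)"
    then obtain N where "N \<ge> 2" "I\<^sub>1 = {0..N}" by blast
    with orth have "N + 1 \<ge> 3 \<and> regular_upto N v" by (auto simp: regular_upto_def)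
    then show ?thesis by blast
  qed
  ultimately have "classical h U X v"
    using pv(1-3) unfolding classical_def by blast
  with v_dual Q show ?thesis by (simp add: u1)
qed

end
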